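(* Let $k\ge1$ be an integer and let $g(k)$ be an integer with $0\le g(k)\le k$. For the bounded-bisection auction with at most $g(k)$ bisections, for the two-bidder $2^{nd}$-price auction on $k$-bit inputs, the average-case objective privacy-approximation ratio with respect to the uniform distribution on $\{0,\ldots,2^k-1\}^2$ equals $$\frac{g(k)+3}{2}-\frac{2^{g(k)}}{2^{k+1}}+\frac{1}{2^{k+1}}-\frac{1}{2^{g(k)+1}}.$$
   Context: Communication model. Bidders $1$ and $2$ hold private inputs $x_1,x_2\in\{0,\ldots,2^k-1\}$ respectively. In a deterministic protocol $P$ the parties exchange (announce) bits; the identity of the next sender is determined by the history of bits sent so far, and each bit is a function of the sender's own input and the history. The sequence of all bits sent on input $(x_1,x_2)$ is the transcript. $P$ is a protocol for a function $f$ if the transcript determines $f(x_1,x_2)$. For an input $(x_1,x_2)$ let $R^P(x_1,x_2)$ be the set of all inputs having the same transcript as $(x_1,x_2)$; it is a combinatorial rectangle on which $f$ is constant. Let $R^I(x_1,x_2)=\{(x_1',x_2'): f(x_1',x_2')=f(x_1,x_2)\}$. The average-case objective privacy-approximation ratio (PAR) of $P$ under a distribution $D$ on inputs is $E_D\big[|R^I(x_1,x_2)|/|R^P(x_1,x_2)|\big]$. $2^{nd}$-price auction: $f(x_1,x_2)=(1,x_2)$ if $x_1\ge x_2$ and $f(x_1,x_2)=(2,x_1)$ if $x_1<x_2$ (identity of the higher bidder, ties in favor of bidder $1$, and the value of the other bidder). Bounded-bisection auction with at most $g(k)$ bisections: start with the interval $[0,2^k)$. Perform up to $g(k)$ bisection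 steps: with current interval $[a,a+2^m)$ containing both values, each of the two bidders announces whether its value lies in the lower half or the upper half. If the answers agree, continue with the common half. If the answers differ, the bidder in the upper half wins, and the exact value of the other bidder is found by binary search on the lower half (run to completion), with only the losing bidder answering. If the answers agree in all $g(k)$ bisection steps, so that both values lie in a common interval $I=[a,a+2^{k-g(k)})$, run the ascending-price English auction on $I$: for $p=a+1,a+2,\ldots,a+2^{k-g(k)}-1$ in turn, ask bidder $2$ whether $x_2<p$; if so, stop (bidder $1$ wins at price $p-1=x_2$); otherwise ask bidder $1$ whether $x_1<p$; if so, stop (bidder $2$ wins at price $p-1=x_1$). If no one ever answers yes, both values equal the maximum of $I$ and bidder $1$ wins at that price. *)

theory Defs
  imports "HOL-Probability.Probability_Mass_Function"
begin

datatype bidder = Bidder1 | Bidder2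

type_synonym input = "nat \<times> nat"

fun bid :: "bidder \<Rightarrow> input \<Rightarrow> nat" where
  "bid Bidder1 x = fst x"
| "bid Bidder2 x = snd x"

definition inputs :: "nat \<Rightarrow> input set" where
  "inputs k = {0..<2 ^ k} \<times> {0..<2 ^ k}"

text \<open>
  A deterministic protocol is a decision tree whose positions are the histories of bits sent
  so far: at \<open>Send i q c\<close>, bidder \<open>i\<close> announces the bit \<open>q x\<^sub>i\<close>, and \<open>c\<close> maps the bit announced
  to the rest of the protocol.  As the history determines who speaks next, the transcript need
  not record the senders.
\<close>

datatype protocol = Halt | Send bidder "nat \<Rightarrow> bool" "bool \<Rightarrow> protocol"

primrec transcript :: "protocol \<Rightarrow> input \<Rightarrow> bool list" where
  "transcript Halt x = []"
| "transcript (Send i q c) x = q (bid i x) # transcript (c (q (bid i x))) x"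

definition protocol_for :: "input set \<Rightarrow> (input \<Rightarrow> 'b) \<Rightarrow> protocol \<Rightarrow> bool" where
  "protocol_for X f P \<longleftrightarrow>
     (\<forall>x\<in>X. \<forall>y\<in>X. transcript P x = transcript P y \<longrightarrow> f x = f y)"

definition ideal_region :: "input set \<Rightarrow> (input \<Rightarrow> 'b) \<Rightarrow> input \<Rightarrow> input set" where
  "ideal_region X f x = {y \<in> X. f y = f x}"

definition protocol_region :: "input set \<Rightarrow> protocol \<Rightarrow> input \<Rightarrow> input set" where
  "protocol_region X P x = {y \<in> X. transcript P y = transcript P x}"

definition average_PAR ::
  "input set \<Rightarrow> (input \<Rightarrow> 'b) \<Rightarrow> protocol \<Rightarrow> input pmf \<Rightarrow> real" where
  "average_PAR X f P D =
     measure_pmf.expectation D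
       (\<lambda>x. real (card (ideal_region X f x)) / real (card (protocol_region X P x)))"

fun second_price :: "input \<Rightarrow> bidder \<times> nat" where
  "second_price (x1, x2) = (if x1 \<ge> x2 then (Bidder1, x2) else (Bidder2, x1))"

text \<open>
  \<open>binary_search i m a\<close>: bidder \<open>i\<close> alone reveals its value, known to lie in \<open>[a, a + 2^m)\<close>.
  The bit \<open>True\<close> stands for the upper half.
\<close>

primrec binary_search :: "bidder \<Rightarrow> nat \<Rightarrow> nat \<Rightarrow> protocol" where
  "binary_search i 0 a = Halt"
| "binary_search i (Suc m) a =
     Send i (\<lambda>v. v \<ge> a + 2 ^ m) (\<lambda>b. binary_search i m (if b then a + 2 ^ m else a))"

text \<open>
  \<open>english_auction n p\<close>: the ascending-price auction with the \<open>n\<close> prices \<open>p, \<dots>, p + n - 1\<close>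
  still to be called.  The bit \<open>True\<close> (``my value is below \<open>p\<close>'') ends the auction.
\<close>

primrec english_auction :: "nat \<Rightarrow> nat \<Rightarrow> protocol" where
  "english_auction 0 p = Halt"
| "english_auction (Suc n) p =
     Send Bidder2 (\<lambda>v. v < p) (\<lambda>b2. if b2 then Halt else
     Send Bidder1 (\<lambda>v. v < p) (\<lambda>b1. if b1 then Halt else
     english_auction n (p + 1)))"

text \<open>
  \<open>bisections j m a\<close>: at most \<open>j\<close> further bisections, starting from the interval
  \<open>[a, a + 2^m)\<close>.  Only \<open>j \<le> m\<close> is meaningful.
\<close>

primrec bisections :: "nat \<Rightarrow> nat \<Rightarrow> nat \<Rightarrow> protocol" where
  "bisections 0 m a = english_auction (2 ^ m - 1) (a + 1)"
| "bisections (Suc j) m a =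
     (let h = a + 2 ^ (m - 1) in
      Send Bidder1 (\<lambda>v. v \<ge> h) (\<lambda>b1.
      Send Bidder2 (\<lambda>v. v \<ge> h) (\<lambda>b2.
        if b1 = b2 then bisections j (m - 1) (if b1 then h else a)
        else binary_search (if b1 then Bidder2 else Bidder1) (m - 1) a)))"

definition bounded_bisection_auction :: "nat \<Rightarrow> nat \<Rightarrow> protocol" where
  "bounded_bisection_auction k g = bisections g k 0"

lemma binary_search_reveals:
  assumes "transcript (binary_search i m a) x = transcript (binary_search i m a) y"
    and "bid i x \<in> {a..<a + 2 ^ m}" and "bid i y \<in> {a..<a + 2 ^ m}"
  shows "bid i x = bid i y"
  using assms by (induction m arbitrary: a) (auto split: if_splits)

lemma english_auction_reveals:
  assumes "transcript (english_auction n p) x = transcript (english_auction n p) y"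
    and "0 < p"
    and "\<And>i. bid i x \<in> {p - 1..<p + n}" and "\<And>i. bid i y \<in> {p - 1..<p + n}"
  shows "second_price x = second_price y"
  using assms
proof (induction n arbitrary: p)
  case 0
  then show ?case
    using "0.prems"(3)[of Bidder1] "0.prems"(3)[of Bidder2]
      "0.prems"(4)[of Bidder1] "0.prems"(4)[of Bidder2]
    by (cases x; cases y) auto
next
  case (Suc n)
  note range = Suc.prems(3)[of Bidder1] Suc.prems(3)[of Bidder2]
    Suc.prems(4)[of Bidder1] Suc.prems(4)[of Bidder2]
  show ?case
  proof (cases "fst x < p \<or> snd x < p \<or> fst y < p \<or> snd y < p")
    case True
    then show ?thesis
      using Suc.prems(1) range by (cases x; cases y) (auto split: if_splits)
  next
    case False
    have "bid i x \<in> {p + 1 - 1..<p + 1 + n}" "bid i y \<in> {p + 1 - 1..<p + 1 + n}" for i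
      using False Suc.prems(3)[of i] Suc.prems(4)[of i] by (cases i; auto)+
    then show ?thesis
      using Suc.IH[of "p + 1"] Suc.prems(1) False by auto
  qed
qed

lemma bisections_reveal:
  assumes "transcript (bisections j m a) x = transcript (bisections j m a) y"
    and "j \<le> m"
    and "\<And>i. bid i x \<in> {a..<a + 2 ^ m}" and "\<And>i. bid i y \<in> {a..<a + 2 ^ m}"
  shows "second_price x = second_price y"
  using assms
proof (induction j arbitrary: m a)
  case 0
  have "bid i x \<in> {a + 1 - 1..<a + 1 + (2 ^ m - 1)}"
    "bid i y \<in> {a + 1 - 1..<a + 1 + (2 ^ m - 1)}" for i
    using "0.prems"(3)[of i] "0.prems"(4)[of i] by auto
  then show ?case
    using english_auction_reveals[of "2 ^ m - 1" "a + 1" x y] "0.prems"(1) by simp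
next
  case (Suc j)
  then obtain m' where m: "m = Suc m'" and "j \<le> m'"
    by (cases m) auto
  define h where "h = a + 2 ^ m'"
  have range: "a \<le> bid i x" "bid i x < h + 2 ^ m'" "a \<le> bid i y" "bid i y < h + 2 ^ m'" for i
    using Suc.prems(3)[of i] Suc.prems(4)[of i] by (auto simp: m h_def)
  have same: "fst x \<ge> h \<longleftrightarrow> fst y \<ge> h" "snd x \<ge> h \<longleftrightarrow> snd y \<ge> h"
    using Suc.prems(1) by (auto simp: m h_def Let_def)
  show ?case
  proof (cases "fst x \<ge> h \<longleftrightarrow> snd x \<ge> h")
    case True
    let ?a = "if fst x \<ge> h then h else a"
    have "bid i x \<in> {?a..<?a + 2 ^ m'}" "bid i y \<in> {?a..<?a + 2 ^ m'}" for i
      using range[of i] True same by (cases i; auto simp: h_def)+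
    moreover have "transcript (bisections j m' ?a) x = transcript (bisections j m' ?a) y"
      using Suc.prems(1) True same by (auto simp: m h_def Let_def)
    ultimately show ?thesis
      using Suc.IH[of m' ?a] \<open>j \<le> m'\<close> by blast
  next
    case False
    let ?i = "if fst x \<ge> h then Bidder2 else Bidder1"
    have "transcript (binary_search ?i m' a) x = transcript (binary_search ?i m' a) y"
      using Suc.prems(1) False same by (auto simp: m h_def Let_def)
    moreover have "bid ?i x \<in> {a..<a + 2 ^ m'}" "bid ?i y \<in> {a..<a + 2 ^ m'}"
      using range[of ?i] False same by (auto simp: h_def)
    ultimately have "bid ?i x = bid ?i y"
      using binary_search_reveals by blast
    then show ?thesis
      using False same by (cases x; cases y) (auto split: if_splits)
  qed
qed

lemma bounded_bisection_auction_correct: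
  assumes "g \<le> k"
  shows "protocol_for (inputs k) second_price (bounded_bisection_auction k g)"
  unfolding protocol_for_def bounded_bisection_auction_def
proof (intro ballI impI)
  fix x y
  assume "x \<in> inputs k" "y \<in> inputs k"
    and eq: "transcript (bisections g k 0) x = transcript (bisections g k 0) y"
  then have "bid i x \<in> {0..<0 + 2 ^ k}" "bid i y \<in> {0..<0 + 2 ^ k}" for i
    by (cases i; auto simp: inputs_def)+
  then show "second_price x = second_price y"
    using bisections_reveal[OF eq assms] by blast
qed

end

theory Submission
  imports Defs
begin

text \<open>
  Summing \<open>|R\<^sup>I(x)| / |R\<^sup>P(x)|\<close> over a single region of the protocol gives the size of the ideal
  region containing it, so the ratio is the sum of \<open>|R\<^sup>I|\<close> over the transcripts, divided by the
  number of inputs.  This sum is additive along the decision tree.  With \<open>N = 2^k\<close>, the ideal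
  regions of \<open>(1, v)\<close> and \<open>(2, v)\<close> have sizes \<open>N - v\<close> and \<open>N - 1 - v\<close>, so a bisection step on
  \<open>[a, a + 2M)\<close> contributes \<open>M (2 (N - a) - M)\<close> through its two unequal answers, and the resulting
  recurrence in the number of bisections has a solution that is affine in \<open>N - a\<close>.
\<close>

definition region_sum :: "(input \<Rightarrow> real) \<Rightarrow> protocol \<Rightarrow> input set \<Rightarrow> real" where
  "region_sum w P X = (\<Sum>x\<in>X. w x / real (card (protocol_region X P x)))"

lemma average_PAR_uniform:
  assumes "finite X" and "X \<noteq> {}"
  shows "average_PAR X f P (pmf_of_set X) =
    region_sum (\<lambda>x. real (card (ideal_region X f x))) P X / real (card X)"
  using assms by (simp add: average_PAR_def region_sum_def integral_pmf_of_set)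

lemma region_sum_cong:
  assumes "\<And>x. x \<in> X \<Longrightarrow> w x = w' x"
  shows "region_sum w P X = region_sum w' P X"
  using assms by (simp add: region_sum_def)

text \<open>At a leaf all of \<open>X\<close> is one region, so the sum is the average of a
  constant. An empty leaf would contribute 0 instead of \<open>c\<close>.\<close>

lemma region_sum_Halt:
  assumes "finite X" and "X \<noteq> {}" and "\<And>x. x \<in> X \<Longrightarrow> w x = c"
  shows "region_sum w Halt X = c"
  using assms by (simp add: region_sum_def protocol_region_def)

text \<open>Inputs that differ in the announced bit never share a transcript, so each region lies
  within one branch. Regions are relative to the inputs reaching a node, while \<open>w\<close>
  still refers to the whole input set.\<close>

lemma region_sum_Send:
  assumes "finite X"
  shows "region_sum w (Send i q c) X =
    region_sum w (c True) {x \<in> X. q (bid i x)} + region_sum w (c False) {x \<in> X. \<not> q (bid i x)}"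
proof -
  let ?T = "{x \<in> X. q (bid i x)}" and ?F = "{x \<in> X. \<not> q (bid i x)}"
  have X: "X = ?T \<union> ?F" by auto
  have T: "protocol_region X (Send i q c) x = protocol_region ?T (c True) x" if "x \<in> ?T" for x
    using that by (auto simp: protocol_region_def)
  have F: "protocol_region X (Send i q c) x = protocol_region ?F (c False) x" if "x \<in> ?F" for x
    using that by (auto simp: protocol_region_def)
  have "region_sum w (Send i q c) X =
      (\<Sum>x\<in>?T \<union> ?F. w x / real (card (protocol_region X (Send i q c) x)))"
    unfolding region_sum_def using X by simp
  also have "\<dots> = (\<Sum>x\<in>?T. w x / real (card (protocol_region X (Send i q c) x))) +
      (\<Sum>x\<in>?F. w x / real (card (protocol_region X (Send i q c) x)))"
    using assms by (intro sum.union_disjoint) auto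
  finally show ?thesis
    by (simp add: region_sum_def T F)
qed

text \<open>The regions are the fibres of \<open>bid i\<close>, and the image hypothesis makes each
  of them nonempty. A fibre therefore counts \<open>u v\<close> once, however many values the other
  bidder can take.\<close>

lemma region_sum_binary_search:
  assumes "finite X" and "bid i ` X = {a..<a + 2 ^ m}" and "\<And>x. x \<in> X \<Longrightarrow> w x = u (bid i x)"
  shows "region_sum w (binary_search i m a) X = (\<Sum>v=a..<a + 2 ^ m. u v)"
  using assms
proof (induction m arbitrary: a X)
  case 0
  then have "w x = u a" if "x \<in> X" for x
    using that by fastforce
  moreover have "X \<noteq> {}"
    using 0 by auto
  ultimately have "region_sum w Halt X = u a"
    using 0 by (intro region_sum_Halt)
  then show ?case
    by simp
next
  case (Suc m)
  let ?h = "a + 2 ^ m"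
  have "bid i ` {x \<in> X. ?h \<le> bid i x} = {v \<in> bid i ` X. ?h \<le> v}"
    by blast
  also have "\<dots> = {?h..<?h + 2 ^ m}"
    unfolding Suc.prems(2) by auto
  finally have upper: "region_sum w (binary_search i m ?h) {x \<in> X. ?h \<le> bid i x} =
      (\<Sum>v=?h..<?h + 2 ^ m. u v)"
    using Suc.prems by (intro Suc.IH) auto
  have "bid i ` {x \<in> X. \<not> ?h \<le> bid i x} = {v \<in> bid i ` X. \<not> ?h \<le> v}"
    by blast
  also have "\<dots> = {a..<?h}"
    unfolding Suc.prems(2) by auto
  finally have lower: "region_sum w (binary_search i m a) {x \<in> X. \<not> ?h \<le> bid i x} =
      (\<Sum>v=a..<?h. u v)"
    using Suc.prems by (intro Suc.IH) auto
  have "(\<Sum>v=a..<?h. u v) + (\<Sum>v=?h..<?h + 2 ^ m. u v) = (\<Sum>v=a..<?h + 2 ^ m. u v)"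
    by (intro sum.atLeastLessThan_concat) auto
  then show ?case
    using Suc.prems(1) upper lower by (simp add: region_sum_Send mult_2 add.assoc)
qed

definition price_weight :: "real \<Rightarrow> input \<Rightarrow> real" where
  "price_weight N x =
    (if snd x \<le> fst x then N - real (snd x) else N - 1 - real (fst x))"

text \<open>An outcome fixes the loser's value and leaves a strip of winner's values. Ties go to
  bidder 1, so only bidder 1's strip contains the price itself; this is the source of the
  \<open>- 1\<close>.\<close>

lemma card_ideal_region_second_price:
  assumes "x \<in> inputs k"
  shows "real (card (ideal_region (inputs k) second_price x)) = price_weight (2 ^ k) x"
proof (cases "snd x \<le> fst x")
  case True
  then have "ideal_region (inputs k) second_price x = {snd x..<2 ^ k} \<times> {snd x}"
    using assms by (cases x) (auto simp: ideal_region_def inputs_def split: if_splits)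
  then show ?thesis
    using True assms by (cases x) (auto simp: price_weight_def inputs_def card_cartesian_product of_nat_diff)
next
  case False
  then have "ideal_region (inputs k) second_price x = {fst x} \<times> {Suc (fst x)..<2 ^ k}"
    using assms by (cases x) (auto simp: ideal_region_def inputs_def split: if_splits)
  then show ?thesis
    using False assms by (cases x) (auto simp: price_weight_def inputs_def card_cartesian_product of_nat_diff)
qed

text \<open>Both outcomes at each of the \<open>M\<close> values would contribute
  \<open>M * (2 * d - M)\<close>. The top value cannot be the price of a win by bidder 2, so that
  outcome's weight \<open>d - M\<close> is subtracted.\<close>

lemma region_sum_english_auction:
  fixes N :: real
  assumes "0 < p" and "M = real n + 1" and "d = N - (real p - 1)"
  shows "region_sum (price_weight N) (english_auction n p) ({p - 1..<p + n} \<times> {p - 1..<p + n}) =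
    M * (2 * d - M) - d + M"
  using assms
proof (induction n arbitrary: p M d)
  case 0
  then have "{p - 1..<p} = {p - 1}"
    by auto
  moreover have "region_sum (price_weight N) Halt {(p - 1, p - 1)} = d"
    using 0 by (intro region_sum_Halt) (auto simp: price_weight_def of_nat_diff)
  ultimately show ?case
    using 0 by simp
next
  case (Suc n)
  let ?A = "{p - 1..<p + Suc n}"
  let ?X = "?A \<times> ?A"
  let ?Y = "{x \<in> ?X. \<not> snd x < p}"
  have "(p - 1, p - 1) \<in> {x \<in> ?X. snd x < p}"
    using Suc.prems(1) by auto
  then have "{x \<in> ?X. snd x < p} \<noteq> {}"
    by blast
  then have 1: "region_sum (price_weight N) Halt {x \<in> ?X. snd x < p} = d"
    using Suc.prems
    by (elim region_sum_Halt[rotated]) (auto simp: price_weight_def of_nat_diff)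
  \<comment> \<open>After a refusal by bidder 2, a yes from bidder 1 means
    \<open>fst x = p - 1 < snd x\<close>, hence the weight \<open>d - 1\<close>.\<close>
  have "(p - 1, p) \<in> {x \<in> ?Y. fst x < p}"
    using Suc.prems(1) by auto
  then have "{x \<in> ?Y. fst x < p} \<noteq> {}"
    by blast
  then have 2: "region_sum (price_weight N) Halt {x \<in> ?Y. fst x < p} = d - 1"
    using Suc.prems
    by (elim region_sum_Halt[rotated]) (auto simp: price_weight_def of_nat_diff)
  \<comment> \<open>The interval loses its lowest value, so \<open>M\<close> and \<open>d\<close>
    both drop by one.\<close>
  have Z: "{x \<in> ?Y. \<not> fst x < p} = {p + 1 - 1..<p + 1 + n} \<times> {p + 1 - 1..<p + 1 + n}"
    by auto
  have "region_sum (price_weight N) (english_auction n (p + 1)) {x \<in> ?Y. \<not> fst x < p} =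
      (M - 1) * (2 * (d - 1) - (M - 1)) - (d - 1) + (M - 1)"
    unfolding Z using Suc.prems by (intro Suc.IH) auto
  moreover have "region_sum (price_weight N) (english_auction (Suc n) p) ?X =
      region_sum (price_weight N) Halt {x \<in> ?X. snd x < p} +
      (region_sum (price_weight N) Halt {x \<in> ?Y. fst x < p} +
       region_sum (price_weight N) (english_auction n (p + 1)) {x \<in> ?Y. \<not> fst x < p})"
    by (simp only: english_auction.simps) (simp add: region_sum_Send)
  ultimately show ?case
    using 1 2 by (simp add: algebra_simps)
qed

lemma sum_diff_interval:
  fixes c :: real
  shows "(\<Sum>v=a..<a + n. c - real v) = real n * (c - real a) - real n * (real n - 1) / 2"
  by (induction n) (auto simp: field_simps)

text \<open>The coefficient of \<open>d\<close> satisfies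
  \<open>s (j + 1) (2 * K) = 2 * s j K + 2 * K\<close>, solved by
  \<open>(j + 2) * M - 2 ^ j\<close>. Here \<open>2 ^ j\<close> counts the final intervals, each
  lacking one outcome of its English auction.\<close>

lemma region_sum_bisections:
  fixes N :: real
  assumes "j \<le> m" and "M = 2 ^ m" and "d = N - real a"
  shows "region_sum (price_weight N) (bisections j m a) ({a..<a + 2 ^ m} \<times> {a..<a + 2 ^ m}) =
    ((real j + 2) * M - 2 ^ j) * d - (real j + 1 + 1 / 2 ^ j) / 2 * M\<^sup>2 + (2 ^ j + 1) / 2 * M"
  using assms
proof (induction j arbitrary: m a M d)
  case 0
  \<comment> \<open>The first price called is \<open>a + 1\<close>, so \<open>2 ^ m\<close> values
    need only \<open>2 ^ m - 1\<close> prices.\<close>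
  have "{a..<a + 2 ^ m} = {(a + 1) - 1..<(a + 1) + (2 ^ m - 1)}"
    by auto
  moreover have "M = real (2 ^ m - 1) + 1"
    using 0 by (simp add: of_nat_diff)
  ultimately have "region_sum (price_weight N) (bisections 0 m a) ({a..<a + 2 ^ m} \<times> {a..<a + 2 ^ m}) =
      M * (2 * d - M) - d + M"
    using 0 region_sum_english_auction[of "a + 1" M "2 ^ m - 1" d N] by simp
  then show ?case
    by (simp add: algebra_simps power2_eq_square)
next
  case (Suc j)
  then obtain n where m: "m = Suc n" and "j \<le> n"
    by (cases m) auto
  let ?L = "{a..<a + 2 ^ n}" and ?h = "a + 2 ^ n"
  let ?H = "{?h..<?h + 2 ^ n}" and ?A = "{a..<a + 2 ^ m}"
  define K :: real where "K = 2 ^ n"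
  have K: "M = 2 * K" "real (2 ^ n) = K"
    using Suc.prems(2) by (simp_all add: m K_def)
  let ?B = "\<lambda>d. ((real j + 2) * K - 2 ^ j) * d - (real j + 1 + 1 / 2 ^ j) / 2 * K\<^sup>2 + (2 ^ j + 1) / 2 * K"
  let ?U = "{x \<in> ?A \<times> ?A. ?h \<le> fst x}" and ?D = "{x \<in> ?A \<times> ?A. \<not> ?h \<le> fst x}"
  have boxes: "{x \<in> ?U. ?h \<le> snd x} = ?H \<times> ?H" "{x \<in> ?U. \<not> ?h \<le> snd x} = ?H \<times> ?L"
    "{x \<in> ?D. ?h \<le> snd x} = ?L \<times> ?H" "{x \<in> ?D. \<not> ?h \<le> snd x} = ?L \<times> ?L"
    by (auto simp: m)
  have "bid Bidder2 ` (?H \<times> ?L) = ?L"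
    by force
  then have "region_sum (price_weight N) (binary_search Bidder2 n a) (?H \<times> ?L) = (\<Sum>v=a..<a + 2 ^ n. N - real v)"
    by (intro region_sum_binary_search) (auto simp: price_weight_def)
  then have HL: "region_sum (price_weight N) (binary_search Bidder2 n a) (?H \<times> ?L) = K * d - K * (K - 1) / 2"
    using Suc.prems(3) by (simp only: sum_diff_interval K)
  have "bid Bidder1 ` (?L \<times> ?H) = ?L"
    by force
  then have "region_sum (price_weight N) (binary_search Bidder1 n a) (?L \<times> ?H) = (\<Sum>v=a..<a + 2 ^ n. (N - 1) - real v)"
    by (intro region_sum_binary_search) (auto simp: price_weight_def)
  then have LH: "region_sum (price_weight N) (binary_search Bidder1 n a) (?L \<times> ?H) = K * (d - 1) - K * (K - 1) / 2"
    using Suc.prems(3) by (simp only: sum_diff_interval K) (simp add: algebra_simps)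
  \<comment> \<open>The upper half starts \<open>K\<close> higher, so its distance to
    \<open>N\<close> is \<open>d - K\<close>.\<close>
  have HH: "region_sum (price_weight N) (bisections j n ?h) (?H \<times> ?H) = ?B (d - K)"
    using Suc.prems(3) by (intro Suc.IH \<open>j \<le> n\<close>) (auto simp: K_def)
  have LL: "region_sum (price_weight N) (bisections j n a) (?L \<times> ?L) = ?B d"
    using Suc.prems(3) by (intro Suc.IH \<open>j \<le> n\<close>) (auto simp: K_def)
  have "region_sum (price_weight N) (bisections (Suc j) m a) (?A \<times> ?A) =
      region_sum (price_weight N) (bisections j n ?h) {x \<in> ?U. ?h \<le> snd x} +
      region_sum (price_weight N) (binary_search Bidder2 n a) {x \<in> ?U. \<not> ?h \<le> snd x} +
      (region_sum (price_weight N) (binary_search Bidder1 n a) {x \<in> ?D. ?h \<le> snd x} +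
       region_sum (price_weight N) (bisections j n a) {x \<in> ?D. \<not> ?h \<le> snd x})"
    by (simp only: bisections.simps Let_def) (simp add: region_sum_Send m)
  also have "\<dots> = ?B (d - K) + (K * d - K * (K - 1) / 2) + (K * (d - 1) - K * (K - 1) / 2 + ?B d)"
    unfolding boxes HL LH HH LL ..
  also have "\<dots> = ((real (Suc j) + 2) * M - 2 ^ Suc j) * d -
      (real (Suc j) + 1 + 1 / 2 ^ Suc j) / 2 * M\<^sup>2 + (2 ^ Suc j + 1) / 2 * M"
    by (simp add: K field_simps power2_eq_square)
  finally show ?case .
qed

theorem theorem5p8:
  fixes k g :: nat
  assumes "k \<ge> 1" and "g \<le> k"
  shows "average_PAR (inputs k) second_price (bounded_bisection_auction k g)
           (pmf_of_set (inputs k)) =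
         (real g + 3) / 2 - 2 ^ g / 2 ^ (k + 1) + 1 / 2 ^ (k + 1) - 1 / 2 ^ (g + 1)"
proof -
  define N :: real where "N = 2 ^ k"
  have "finite (inputs k)" "inputs k \<noteq> {}" "real (card (inputs k)) = N\<^sup>2"
    by (auto simp: inputs_def card_cartesian_product N_def power2_eq_square)
  then have "average_PAR (inputs k) second_price (bounded_bisection_auction k g) (pmf_of_set (inputs k)) =
      region_sum (price_weight N) (bisections g k 0) (inputs k) / N\<^sup>2"
    by (simp add: average_PAR_uniform card_ideal_region_second_price bounded_bisection_auction_def
        N_def cong: region_sum_cong)
  \<comment> \<open>The initial interval starts at 0 and has length \<open>N\<close>, so both
    \<open>M\<close> and \<open>d\<close> equal \<open>N\<close>.\<close>
  also have "region_sum (price_weight N) (bisections g k 0) (inputs k) =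
      ((real g + 2) * N - 2 ^ g) * N - (real g + 1 + 1 / 2 ^ g) / 2 * N\<^sup>2 + (2 ^ g + 1) / 2 * N"
    using region_sum_bisections[OF assms(2), of N N N 0] by (simp add: inputs_def N_def)
  also have "\<dots> / N\<^sup>2 = (real g + 3) / 2 - 2 ^ g / (2 * N) + 1 / (2 * N) - 1 / (2 * 2 ^ g)"
  proof -
    have "N \<noteq> 0" by (simp add: N_def)
    then show ?thesis by (simp add: field_simps power2_eq_square)
  qed
  finally show ?thesis
    by (simp add: N_def)
qed

end
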